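(* Let $n=2s-1$ and let $(\lambda_2,\ldots,\lambda_n)$ be any list of complex numbers which is closed under complex conjugation and such that none of them is real, indexed so that $\lambda_2,\ldots,\lambda_s$ contains exactly one member of each complex conjugate pair. Let $x_i=\Re(\lambda_i)$ and $y_i=\Im(\lambda_i)$ for $i=2,\ldots,s$, and let $$w=\min\{\pm x_2,\pm y_2,\ldots,\pm x_s,\pm y_s\}.$$ Then there exists a least real number $\lambda_0$ with $$\max_{2\le j\le n}|\lambda_j|\le\lambda_0\le n|w|$$ such that the list of complex numbers $(\lambda_1;\lambda_2,\ldots,\lambda_n)$ is realizable if and only if $\lambda_1\ge\lambda_0$.
   Context: Lists are considered with multiplicity. A list $(\lambda_1;\lambda_2,\ldots,\lambda_n)$, with a semicolon after the first entry, is realizable if it is the spectrum (list of eigenvalues counted with multiplicity) of an $n\times n$ matrix with real nonnegative entries whose Perron eigenvalue (the nonnegative eigenvalue that is at least the modulus of every other eigenvalue) is $\lambda_1$. The notation $\min\{\pm a,\pm b,\ldots\}$ means the minimum of the set containing $a,-a,b,-b,\ldots$. *)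

theory Defs
  imports Complex_Main
    "Jordan_Normal_Form.Char_Poly"
begin

(* The library's spectrum of a matrix is a set; here eigenvalues are listed with algebraic
   multiplicity, as the roots of the characteristic polynomial over the complex numbers. *)
definition spectrum_mset :: "real mat \<Rightarrow> complex multiset" where
  "spectrum_mset A = proots (char_poly (map_mat complex_of_real A))"

definition perron_eigenvalue :: "real mat \<Rightarrow> real \<Rightarrow> bool" where
  "perron_eigenvalue A r \<longleftrightarrow>
     0 \<le> r \<and> eigenvalue A r \<and> (\<forall>z \<in># spectrum_mset A. cmod z \<le> r)"

(* "realizable r ls" renders realizability of the list (r; ls), in which the entry before the
   semicolon is the Perron eigenvalue and hence real. *)
definition realizable :: "real \<Rightarrow> complex list \<Rightarrow> bool" where
  "realizable r ls \<longleftrightarrow>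
     (\<exists>A \<in> carrier_mat (Suc (length ls)) (Suc (length ls)).
        (\<forall>a \<in> elements_mat A. 0 \<le> a) \<and>
        spectrum_mset A = mset (complex_of_real r # ls) \<and>
        perron_eigenvalue A r)"

end

theory Submission
  imports Defs
begin

text \<open>Every nonnegative matrix is cospectral to a nonnegative matrix with constant row sums, which are
  then the Perron eigenvalue. Such matrices with bounded row sums form a compact set, so the set
  of all \<open>\<lambda>\<^sub>1\<close> for which the list is realizable is closed. Passing to the quotient by the all-ones vector
  splits off exactly the Perron eigenvalue and forgets any multiple of the all-ones vector added to a column;
  adding \<open>\<epsilon>\<close> to the first column therefore raises \<open>\<lambda>\<^sub>1\<close> by \<open>\<epsilon>\<close> and keeps the other
  eigenvalues. Hence the realizable values form a closed upper ray. That \<open>n * \<bar>w\<bar>\<close> lies on it follows by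
  lifting a block diagonal real matrix with the eigenvalues \<open>\<lambda>\<^sub>2, \<dots>, \<lambda>\<^sub>n\<close> from the quotient to a nonnegative matrix.\<close>

section \<open>Compactness\<close>

text \<open>Bolzano-Weierstrass in finitely many coordinates: the new coordinate has a monotone
  subsequence, which converges because it is bounded, and the coordinates treated before still
  converge along it.\<close>

lemma finite_family_convergent_subseq:
  fixes X :: "'i \<Rightarrow> nat \<Rightarrow> real"
  assumes "finite I" and "\<And>i. i \<in> I \<Longrightarrow> Bseq (X i)"
  shows "\<exists>f :: nat \<Rightarrow> nat. strict_mono f \<and> (\<forall>i\<in>I. convergent (\<lambda>k. X i (f k)))"
  using assms
proof (induction I rule: finite_induct)
  case empty
  show ?case by (rule exI[of _ id]) (simp add: strict_mono_def)
next
  case (insert a I)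
  then obtain f :: "nat \<Rightarrow> nat" where f: "strict_mono f" "\<forall>i\<in>I. convergent (\<lambda>k. X i (f k))"
    by blast
  obtain g :: "nat \<Rightarrow> nat" where g: "strict_mono g" "monoseq (\<lambda>k. X a (f (g k)))"
    using seq_monosub[of "\<lambda>k. X a (f k)"] by auto
  have "Bseq (\<lambda>k. X a (f (g k)))"
    using Bseq_subseq[of "X a" "f \<circ> g"] insert.prems by (simp add: o_def)
  then have "convergent (\<lambda>k. X a (f (g k)))"
    using g(2) by (rule Bseq_monoseq_convergent)
  moreover have "convergent (\<lambda>k. X i (f (g k)))" if "i \<in> I" for i
    using f(2) that convergent_subseq_convergent[of "\<lambda>k. X i (f k)" g] g(1)
    by (auto simp: o_def)
  moreover have "strict_mono (\<lambda>k. f (g k))"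
    using strict_mono_o[OF f(1) g(1)] by (simp add: o_def)
  ultimately show ?case by (intro exI[of _ "\<lambda>k. f (g k)"]) auto
qed

text \<open>By the Leibniz formula the value at a fixed \<open>t\<close> is a polynomial in the
  entries, hence continuous in them. Convergence of values is enough later, since a real polynomial
  is determined by its values.\<close>

lemma poly_char_poly_tendsto:
  fixes X :: "nat \<Rightarrow> real mat"
  assumes X: "\<And>k. X k \<in> carrier_mat n n" and B: "B \<in> carrier_mat n n"
    and lim: "\<And>i j. i < n \<Longrightarrow> j < n \<Longrightarrow> (\<lambda>k. X k $$ (i, j)) \<longlonglongrightarrow> B $$ (i, j)"
  shows "(\<lambda>k. poly (char_poly (X k)) t) \<longlonglongrightarrow> poly (char_poly B) t"
proof -
  have expand: "poly (char_poly M) t =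
      (\<Sum>p\<in>{p. p permutes {0..<n}}. signof p * (\<Prod>i=0..<n. (if i = p i then t else 0) - M $$ (i, p i)))"
    if M: "M \<in> carrier_mat n n" for M :: "real mat"
  proof -
    have "poly (char_poly M) t = det (- char_matrix M t)"
      by (rule char_poly_matrix[OF M])
    also have "\<dots> = (\<Sum>p\<in>{p. p permutes {0..<n}}. signof p * (\<Prod>i=0..<n. (- char_matrix M t) $$ (i, p i)))"
      by (rule det_def') (use M in \<open>auto simp: char_matrix_def\<close>)
    also have "\<dots> = (\<Sum>p\<in>{p. p permutes {0..<n}}. signof p * (\<Prod>i=0..<n. (if i = p i then t else 0) - M $$ (i, p i)))"
    proof (intro sum.cong prod.cong arg_cong2[of _ _ _ _ "(*)"] refl)
      fix p i assume "p \<in> {p. p permutes {0..<n}}" "i \<in> {0..<n}"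
      then have "i < n" "p i < n" using permutes_in_image[of p "{0..<n}" i] by auto
      then show "(- char_matrix M t) $$ (i, p i) = (if i = p i then t else 0) - M $$ (i, p i)"
        using M by (auto simp: char_matrix_def)
    qed
    finally show ?thesis .
  qed
  show ?thesis
    unfolding expand[OF X] expand[OF B]
  proof (intro tendsto_sum tendsto_mult tendsto_prod tendsto_diff tendsto_const lim)
    fix p i assume "p \<in> {p. p permutes {0..<n}}" "i \<in> {0..<n}"
    then show "i < n" "p i < n" using permutes_in_image[of p "{0..<n}" i] by auto
  qed
qed

definition nonneg_row_sum_mat :: "nat \<Rightarrow> real \<Rightarrow> real mat \<Rightarrow> bool" where
  "nonneg_row_sum_mat n r B \<longleftrightarrow> B \<in> carrier_mat n n \<and>
     (\<forall>i<n. \<forall>j<n. 0 \<le> B $$ (i, j)) \<and> (\<forall>i<n. (\<Sum>j<n. B $$ (i, j)) = r)"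

lemma nonneg_row_sum_matD:
  assumes "nonneg_row_sum_mat n r B"
  shows "B \<in> carrier_mat n n" "\<And>i j. i < n \<Longrightarrow> j < n \<Longrightarrow> 0 \<le> B $$ (i, j)"
    "\<And>i. i < n \<Longrightarrow> (\<Sum>j<n. B $$ (i, j)) = r"
  using assms by (auto simp: nonneg_row_sum_mat_def)

lemma nonneg_row_sum_mat_le:
  assumes "nonneg_row_sum_mat n r B" "i < n" "j < n"
  shows "B $$ (i, j) \<le> r"
  using member_le_sum[of j "{..<n}" "\<lambda>j. B $$ (i, j)"] nonneg_row_sum_matD[OF assms(1)] assms(2,3)
  by auto

lemma nonneg_row_sum_mat_nonneg:
  assumes "nonneg_row_sum_mat n r B" "n > 0"
  shows "0 \<le> r"
  using nonneg_row_sum_mat_le[OF assms(1), of 0 0] nonneg_row_sum_matD(2)[OF assms(1), of 0 0] assms(2)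
  by linarith

text \<open>Each entry lies between 0 and its row sum, so bounded row sums keep the matrices in a
  compact set. The hypothesis on the limit concerns only the characteristic polynomials, so the
  \<open>X k\<close> themselves need not converge.\<close>

lemma nonneg_row_sum_mat_limit:
  fixes X :: "nat \<Rightarrow> real mat"
  assumes X: "\<And>k. nonneg_row_sum_mat n (r k) (X k)" and r: "Bseq r" and n: "n > 0"
    and p: "\<And>t. (\<lambda>k. poly (char_poly (X k)) t) \<longlonglongrightarrow> poly p t"
  shows "\<exists>f r' B. strict_mono (f :: nat \<Rightarrow> nat) \<and> (\<lambda>k. r (f k)) \<longlonglongrightarrow> r' \<and>
    nonneg_row_sum_mat n r' B \<and> char_poly B = p"
proof -
  note XD = nonneg_row_sum_matD[OF X]
  obtain C where C: "\<And>k. \<bar>r k\<bar> \<le> C"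
    using r unfolding Bseq_def by auto
  have "Bseq (\<lambda>k. X k $$ ij)" if "ij \<in> {..<n} \<times> {..<n}" for ij
  proof (rule BseqI')
    fix k
    obtain i j where ij: "ij = (i, j)" "i < n" "j < n" using \<open>ij \<in> _\<close> by auto
    show "norm (X k $$ ij) \<le> C"
      using XD(2)[OF ij(2,3), of k] nonneg_row_sum_mat_le[OF X ij(2,3), of k] C[of k] ij(1) by auto
  qed
  then obtain f :: "nat \<Rightarrow> nat" where f: "strict_mono f"
    and "\<forall>ij \<in> {..<n} \<times> {..<n}. convergent (\<lambda>k. X (f k) $$ ij)"
    using finite_family_convergent_subseq[of "{..<n} \<times> {..<n}" "\<lambda>ij k. X k $$ ij"] by auto
  then have "\<forall>ij \<in> {..<n} \<times> {..<n}. \<exists>l. (\<lambda>k. X (f k) $$ ij) \<longlonglongrightarrow> l"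
    by (simp add: convergent_def)
  then obtain b where b: "\<And>ij. ij \<in> {..<n} \<times> {..<n} \<Longrightarrow> (\<lambda>k. X (f k) $$ ij) \<longlonglongrightarrow> b ij"
    by metis
  define B where "B = mat n n b"
  have B: "B \<in> carrier_mat n n" by (simp add: B_def)
  have lim: "(\<lambda>k. X (f k) $$ (i, j)) \<longlonglongrightarrow> B $$ (i, j)" if "i < n" "j < n" for i j
    using b[of "(i, j)"] that by (simp add: B_def)
  have rows: "(\<lambda>k. r (f k)) \<longlonglongrightarrow> (\<Sum>j<n. B $$ (i, j))" if "i < n" for i
  proof -
    have "(\<lambda>k. \<Sum>j<n. X (f k) $$ (i, j)) \<longlonglongrightarrow> (\<Sum>j<n. B $$ (i, j))"
      using that by (intro tendsto_sum lim) auto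
    then show ?thesis using XD(3)[OF that] by simp
  qed
  define r' where "r' = (\<Sum>j<n. B $$ (0, j))"
  have "0 \<le> B $$ (i, j)" if "i < n" "j < n" for i j
    using lim[OF that] XD(2)[OF that] by (intro LIMSEQ_le_const) auto
  moreover have "(\<Sum>j<n. B $$ (i, j)) = r'" if "i < n" for i
    using LIMSEQ_unique[OF rows[OF that] rows[of 0]] n by (simp add: r'_def)
  ultimately have "nonneg_row_sum_mat n r' B"
    using B by (simp add: nonneg_row_sum_mat_def)
  moreover have "char_poly B = p"
  proof (rule poly_eq_poly_eq_iff[THEN iffD1], rule ext)
    fix t
    show "poly (char_poly B) t = poly p t"
    proof (rule LIMSEQ_unique)
      show "(\<lambda>k. poly (char_poly (X (f k))) t) \<longlonglongrightarrow> poly (char_poly B) t"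
        by (rule poly_char_poly_tendsto[OF XD(1) B lim])
      show "(\<lambda>k. poly (char_poly (X (f k))) t) \<longlonglongrightarrow> poly p t"
        using LIMSEQ_subseq_LIMSEQ[OF p f] by (simp add: o_def)
    qed
  qed
  ultimately show ?thesis using f rows[OF n] unfolding r'_def by blast
qed

section \<open>Constant row sums\<close>

text \<open>Collatz--Wielandt: the eigenvalue is the largest \<open>\<rho>\<close> such that \<open>M v \<ge> \<rho> v\<close> for some
  nonnegative unit vector \<open>v\<close>. If the maximum were attained with \<open>M v \<noteq> \<rho> v\<close>, then \<open>M v\<close> would be
  a vector with strict inequality in every coordinate, so \<open>\<rho>\<close> could be increased.\<close>
lemma positive_matrix_eigenvector:
  fixes M :: "nat \<Rightarrow> nat \<Rightarrow> real"
  assumes M: "\<And>i j. i < n \<Longrightarrow> j < n \<Longrightarrow> 0 < M i j" and n: "n > 0"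
  obtains r v where "\<And>i. i < n \<Longrightarrow> 0 < v i" "\<And>i. i < n \<Longrightarrow> (\<Sum>j<n. M i j * v j) = r * v i"
    "0 \<le> r" "r \<le> (\<Sum>i<n. \<Sum>j<n. M i j)"
proof -
  define S where "S = {\<rho>. \<exists>v. (\<forall>i<n. 0 \<le> v i) \<and> (\<Sum>i<n. v i) = 1 \<and>
    (\<forall>i<n. \<rho> * v i \<le> (\<Sum>j<n. M i j * v j))}"
  have le1: "v i \<le> 1" if "\<forall>i<n. 0 \<le> v i" "(\<Sum>i<n. v i) = 1" "i < n" for v :: "nat \<Rightarrow> real" and i
    using member_le_sum[of i "{..<n}" v] that by auto
  have "0 \<in> S"
    unfolding S_def mem_Collect_eq
  proof (intro exI[of _ "\<lambda>i. 1 / real n"] conjI allI impI)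
    fix i assume "i < n"
    then have "0 \<le> (\<Sum>j<n. M i j * (1 / real n))"
      using M by (intro sum_nonneg mult_nonneg_nonneg) (auto intro: less_imp_le)
    then show "0 * (1 / real n) \<le> (\<Sum>j<n. M i j * (1 / real n))" by simp
  qed (use n in auto)
  \<comment> \<open>Sum the inequalities over all coordinates and use
    \<open>v j \<le> 1\<close>.\<close>
  have bdd: "\<rho> \<le> (\<Sum>i<n. \<Sum>j<n. M i j)" if "\<rho> \<in> S" for \<rho>
  proof -
    obtain v where v: "\<forall>i<n. 0 \<le> v i" "(\<Sum>i<n. v i) = 1"
      "\<forall>i<n. \<rho> * v i \<le> (\<Sum>j<n. M i j * v j)" using \<open>\<rho> \<in> S\<close> by (auto simp: S_def)
    have "\<rho> = (\<Sum>i<n. \<rho> * v i)" using v(2) by (simp add: sum_distrib_left[symmetric])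
    also have "\<dots> \<le> (\<Sum>i<n. \<Sum>j<n. M i j * v j)" using v(3) by (intro sum_mono) auto
    also have "\<dots> \<le> (\<Sum>i<n. \<Sum>j<n. M i j)"
    proof (intro sum_mono)
      fix i j assume "i \<in> {..<n}" "j \<in> {..<n}"
      then show "M i j * v j \<le> M i j"
        using mult_left_mono[OF le1[OF v(1,2), of j], of "M i j"] M[of i j] by auto
    qed
    finally show ?thesis .
  qed
  then have bdd_above: "bdd_above S" by (auto simp: bdd_above_def)
  define r where "r = Sup S"
  have "\<exists>\<rho>\<in>S. r - 1 / real (Suc k) < \<rho>" for k
    using less_cSup_iff[OF _ bdd_above, of "r - 1 / real (Suc k)"] \<open>0 \<in> S\<close> by (auto simp: r_def)
  then obtain \<rho> where \<rho>: "\<And>k. \<rho> k \<in> S" "\<And>k. r - 1 / real (Suc k) < \<rho> k" by metis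
  have \<rho>_le: "\<rho> k \<le> r" for k using cSup_upper[OF \<rho>(1) bdd_above] by (simp add: r_def)
  have \<rho>_lim: "\<rho> \<longlonglongrightarrow> r"
  proof (rule tendsto_sandwich)
    have "(\<lambda>k. r - inverse (real (Suc k))) \<longlonglongrightarrow> r - 0"
      by (intro tendsto_diff tendsto_const LIMSEQ_inverse_real_of_nat)
    then show "(\<lambda>k. r - 1 / real (Suc k)) \<longlonglongrightarrow> r" by (simp add: inverse_eq_divide)
    show "(\<lambda>_. r) \<longlonglongrightarrow> r" by simp
    show "\<forall>\<^sub>F k in sequentially. r - 1 / real (Suc k) \<le> \<rho> k"
      by (intro always_eventually allI less_imp_le \<rho>(2))
    show "\<forall>\<^sub>F k in sequentially. \<rho> k \<le> r" using \<rho>_le by simp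
  qed
  \<comment> \<open>The near-optimal vectors lie in the standard simplex, which is compact; a
    subsequence has a limit \<open>u\<close>, for which the supremum \<open>r\<close> is
    attained.\<close>
  have "\<forall>k. \<exists>v. (\<forall>i<n. 0 \<le> v i) \<and> (\<Sum>i<n. v i) = 1 \<and> (\<forall>i<n. \<rho> k * v i \<le> (\<Sum>j<n. M i j * v j))"
    using \<rho>(1) by (auto simp: S_def)
  then obtain v where v: "\<And>k i. i < n \<Longrightarrow> 0 \<le> v k i" "\<And>k. (\<Sum>i<n. v k i) = (1::real)"
    "\<And>k i. i < n \<Longrightarrow> \<rho> k * v k i \<le> (\<Sum>j<n. M i j * v k j)" by metis
  have "Bseq (\<lambda>k. v k i)" if "i \<in> {..<n}" for i
    by (rule BseqI'[of _ 1]) (use that v(1) le1[of "v _" i] v in auto)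
  then obtain f :: "nat \<Rightarrow> nat" where f: "strict_mono f" "\<forall>i\<in>{..<n}. convergent (\<lambda>k. v (f k) i)"
    using finite_family_convergent_subseq[of "{..<n}" "\<lambda>i k. v k i"] by auto
  then have "\<forall>i\<in>{..<n}. \<exists>l. (\<lambda>k. v (f k) i) \<longlonglongrightarrow> l" by (simp add: convergent_def)
  then obtain u where u: "\<And>i. i < n \<Longrightarrow> (\<lambda>k. v (f k) i) \<longlonglongrightarrow> u i" by (metis lessThan_iff)
  have u0: "0 \<le> u i" if "i < n" for i
    using u[OF that] v(1)[OF that] by (intro LIMSEQ_le_const) auto
  have u1: "(\<Sum>i<n. u i) = 1"
  proof (rule LIMSEQ_unique)
    show "(\<lambda>k. \<Sum>i<n. v (f k) i) \<longlonglongrightarrow> (\<Sum>i<n. u i)" by (intro tendsto_sum u) auto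
    show "(\<lambda>k. \<Sum>i<n. v (f k) i) \<longlonglongrightarrow> 1" by (simp add: v(2))
  qed
  define w where "w i = (\<Sum>j<n. M i j * u j)" for i
  have le_w: "r * u i \<le> w i" if "i < n" for i
  proof (rule LIMSEQ_le)
    have "(\<lambda>k. \<rho> (f k)) \<longlonglongrightarrow> r"
      using LIMSEQ_subseq_LIMSEQ[OF \<rho>_lim f(1)] by (simp add: o_def)
    then show "(\<lambda>k. \<rho> (f k) * v (f k) i) \<longlonglongrightarrow> r * u i" using u[OF that] by (rule tendsto_mult)
    show "(\<lambda>k. \<Sum>j<n. M i j * v (f k) j) \<longlonglongrightarrow> w i"
      unfolding w_def by (intro tendsto_sum tendsto_mult tendsto_const u) auto
    show "\<exists>N. \<forall>k\<ge>N. \<rho> (f k) * v (f k) i \<le> (\<Sum>j<n. M i j * v (f k) j)" using v(3)[OF that] by auto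
  qed
  obtain i0 where i0: "i0 < n" "0 < u i0"
    using u0 u1 by (metis lessThan_iff less_eq_real_def sum.neutral zero_neq_one)
  \<comment> \<open>Needed twice: for \<open>u\<close>, which makes \<open>w\<close> positive, and
    for the gap between \<open>w\<close> and \<open>r * u\<close>, which makes \<open>d\<close>
    positive once a single coordinate of the gap is nonzero.\<close>
  have positive_image: "0 < (\<Sum>j<n. M i j * z j)"
    if "i < n" "\<And>j. j < n \<Longrightarrow> 0 \<le> z j" "j < n" "0 < z j" for z i j
  proof (rule sum_pos2[of _ j])
    show "0 \<le> M i k * z k" if "k \<in> {..<n}" for k
      using that \<open>i < n\<close> M[of i k] \<open>\<And>j. j < n \<Longrightarrow> 0 \<le> z j\<close>[of k] by simp
  qed (use that M in auto)
  have w_pos: "0 < w i" if "i < n" for i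
    unfolding w_def using positive_image[of i u i0] that u0 i0 by auto
  have eq: "w i = r * u i" if i: "i < n" for i
  proof (rule ccontr)
    assume "w i \<noteq> r * u i"
    then have gap: "0 < w i - r * u i" using le_w[OF i] by simp
    define d where "d k = (\<Sum>j<n. M k j * w j) - r * w k" for k
    have d_pos: "0 < d k" if "k < n" for k
    proof -
      have "0 < (\<Sum>j<n. M k j * (w j - r * u j))"
        using positive_image[of k "\<lambda>j. w j - r * u j" i] that gap i le_w by auto
      also have "\<dots> = (\<Sum>j<n. M k j * w j) - r * (\<Sum>j<n. M k j * u j)"
        by (simp add: algebra_simps sum_subtractf sum_distrib_left)
      finally show ?thesis by (simp add: d_def w_def)
    qed
    \<comment> \<open>The smallest relative excess of the image of \<open>w\<close> over
      \<open>r\<close> times \<open>w\<close>: raising \<open>r\<close> by this amount keeps the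
      inequality in every coordinate, against the maximality of \<open>r\<close>.\<close>
    define \<epsilon> where "\<epsilon> = Min ((\<lambda>k. d k / w k) ` {..<n})"
    have "{..<n} \<noteq> {}" using n by auto
    then have \<epsilon>: "0 < \<epsilon>" unfolding \<epsilon>_def using d_pos w_pos by (subst Min_gr_iff) auto
    have \<epsilon>_le: "\<epsilon> * w k \<le> d k" if "k < n" for k
    proof -
      have "\<epsilon> \<le> d k / w k" unfolding \<epsilon>_def using that by (intro Min_le) auto
      then show ?thesis using w_pos[OF that] by (simp add: field_simps)
    qed
    define W where "W = (\<Sum>i<n. w i)"
    have W: "0 < W" unfolding W_def using w_pos n by (intro sum_pos) auto
    have "r + \<epsilon> \<in> S"
      unfolding S_def mem_Collect_eq
    proof (intro exI[of _ "\<lambda>i. w i / W"] conjI allI impI)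
      fix k assume k: "k < n"
      show "0 \<le> w k / W" using w_pos[OF k] W by simp
      have "(r + \<epsilon>) * w k \<le> (\<Sum>j<n. M k j * w j)"
        using \<epsilon>_le[OF k] by (simp add: d_def algebra_simps)
      then show "(r + \<epsilon>) * (w k / W) \<le> (\<Sum>j<n. M k j * (w j / W))"
        using W by (simp add: sum_divide_distrib[symmetric] divide_right_mono)
    next
      show "(\<Sum>i<n. w i / W) = 1" using W by (simp add: sum_divide_distrib[symmetric] W_def[symmetric])
    qed
    then show False using cSup_upper[OF _ bdd_above] \<epsilon> unfolding r_def by force
  qed
  have "0 < u i" if "i < n" for i
    using eq[OF that] w_pos[OF that] u0[OF that] by (cases "u i = 0") auto
  moreover have "(\<Sum>j<n. M i j * u j) = r * u i" if "i < n" for i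
    using eq[OF that] by (simp add: w_def)
  moreover have "0 \<le> r" unfolding r_def by (rule cSup_upper[OF \<open>0 \<in> S\<close> bdd_above])
  moreover have "r \<le> (\<Sum>i<n. \<Sum>j<n. M i j)"
    unfolding r_def using \<open>0 \<in> S\<close> bdd by (intro cSup_least) auto
  ultimately show ?thesis by (rule that)
qed

text \<open>Conjugation by the diagonal matrix of \<open>v\<close>. If \<open>v\<close> is an
  eigenvector, every row of the scaled matrix sums to the eigenvalue.\<close>

lemma char_poly_diagonal_scaling:
  fixes A :: "'a :: field mat"
  assumes A: "A \<in> carrier_mat n n" and v: "\<And>i. i < n \<Longrightarrow> v i \<noteq> 0"
  shows "char_poly (mat n n (\<lambda>(i, j). A $$ (i, j) * v j / v i)) = char_poly A"
proof (rule char_poly_similar, rule similar_matI)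
  let ?P = "mat_diag n (\<lambda>i. 1 / v i)" and ?Q = "mat_diag n v"
  show "{mat n n (\<lambda>(i, j). A $$ (i, j) * v j / v i), A, ?P, ?Q} \<subseteq> carrier_mat n n"
    using A by auto
  show "?P * ?Q = 1\<^sub>m n" "?Q * ?P = 1\<^sub>m n"
    unfolding mat_diag_diag using v by (auto simp: mat_diag_def intro!: eq_matI)
  show "mat n n (\<lambda>(i, j). A $$ (i, j) * v j / v i) = ?P * A * ?Q"
    by (subst mat_diag_mult_left[OF A], subst mat_diag_mult_right[of _ n n]) (auto intro!: eq_matI)
qed

text \<open>Perturb \<open>A\<close> to a positive matrix, scale it by its positive eigenvector to make the row sums
  constant, and take a limit; only the limit of the scaled matrices need exist, not of the scalings.\<close>
lemma cospectral_nonneg_row_sum_mat: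
  fixes A :: "real mat"
  assumes A: "A \<in> carrier_mat n n" and nonneg: "\<And>i j. i < n \<Longrightarrow> j < n \<Longrightarrow> 0 \<le> A $$ (i, j)"
    and n: "n > 0"
  shows "\<exists>r B. nonneg_row_sum_mat n r B \<and> char_poly B = char_poly A"
proof -
  define Y where "Y k = mat n n (\<lambda>ij. A $$ ij + inverse (real (Suc k)))" for k
  have Y: "Y k \<in> carrier_mat n n" for k by (simp add: Y_def)
  have Y_pos: "0 < Y k $$ (i, j)" if "i < n" "j < n" for i j k
    using nonneg[OF that] that by (simp add: Y_def add_nonneg_pos)
  define Q where "Q k r v \<longleftrightarrow> (\<forall>i<n. 0 < v i) \<and> (\<forall>i<n. (\<Sum>j<n. Y k $$ (i, j) * v j) = r * v i) \<and>
      0 \<le> r \<and> r \<le> (\<Sum>i<n. \<Sum>j<n. Y k $$ (i, j))" for k r v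
  have "\<exists>r v. Q k r v" for k
    unfolding Q_def
    by (rule positive_matrix_eigenvector[of n "\<lambda>i j. Y k $$ (i, j)"]) (use Y_pos n in auto)
  then obtain r v where "\<And>k. Q k (r k) (v k)" by metis
  then have v: "\<And>k i. i < n \<Longrightarrow> 0 < v k i"
    and ev: "\<And>k i. i < n \<Longrightarrow> (\<Sum>j<n. Y k $$ (i, j) * v k j) = r k * v k i"
    and r: "\<And>k. 0 \<le> r k" "\<And>k. r k \<le> (\<Sum>i<n. \<Sum>j<n. Y k $$ (i, j))"
    by (simp_all add: Q_def)
  define X where "X k = mat n n (\<lambda>(i, j). Y k $$ (i, j) * v k j / v k i)" for k
  have X: "nonneg_row_sum_mat n (r k) (X k)" for k
    unfolding nonneg_row_sum_mat_def
  proof (intro conjI allI impI)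
    show "X k \<in> carrier_mat n n" by (simp add: X_def)
    fix i assume i: "i < n"
    show "0 \<le> X k $$ (i, j)" if "j < n" for j
      using i that v Y_pos[OF i that, of k] by (simp add: X_def less_imp_le)
    have "(\<Sum>j<n. X k $$ (i, j)) = (\<Sum>j<n. Y k $$ (i, j) * v k j) / v k i"
      using i by (simp add: X_def sum_divide_distrib)
    then show "(\<Sum>j<n. X k $$ (i, j)) = r k"
      using ev[OF i, of k] v[OF i, of k] by simp
  qed
  have cp: "char_poly (X k) = char_poly (Y k)" for k
    unfolding X_def by (rule char_poly_diagonal_scaling[OF Y]) (use v in \<open>metis less_irrefl\<close>)
  \<comment> \<open>The perturbations are at most 1, so bounding the eigenvalue by the sum of all
    entries is uniform in \<open>k\<close>.\<close>
  have "Bseq r"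
  proof (rule BseqI')
    fix k
    have "r k \<le> (\<Sum>i<n. \<Sum>j<n. Y k $$ (i, j))" by (rule r)
    also have "\<dots> \<le> (\<Sum>i<n. \<Sum>j<n. A $$ (i, j) + 1)"
      by (intro sum_mono) (auto simp: Y_def inverse_le_1_iff)
    finally show "norm (r k) \<le> (\<Sum>i<n. \<Sum>j<n. A $$ (i, j) + 1)" using r(1)[of k] by simp
  qed
  moreover have "(\<lambda>k. poly (char_poly (X k)) t) \<longlonglongrightarrow> poly (char_poly A) t" for t
    unfolding cp
  proof (rule poly_char_poly_tendsto[OF Y A])
    fix i j assume "i < n" "j < n"
    moreover have "(\<lambda>k. A $$ (i, j) + inverse (real (Suc k))) \<longlonglongrightarrow> A $$ (i, j) + 0"
      by (intro tendsto_add tendsto_const LIMSEQ_inverse_real_of_nat)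
    ultimately show "(\<lambda>k. Y k $$ (i, j)) \<longlonglongrightarrow> A $$ (i, j)" by (simp add: Y_def)
  qed
  ultimately show ?thesis using nonneg_row_sum_mat_limit[of n r X "char_poly A"] X n by blast
qed

text \<open>Read the eigenvector equation at a coordinate of largest modulus: the triangle
  inequality bounds the eigenvalue by the row sum there.\<close>

lemma nonneg_row_sum_mat_eigenvalue_le:
  assumes B: "nonneg_row_sum_mat n r B"
    and z: "poly (char_poly (map_mat complex_of_real B)) z = 0"
  shows "cmod z \<le> r"
proof -
  note BD = nonneg_row_sum_matD[OF B]
  have "eigenvalue (map_mat complex_of_real B) z"
    using z eigenvalue_root_char_poly[of "map_mat complex_of_real B" n z] BD(1) by simp
  then obtain v where v: "v \<in> carrier_vec n" "v \<noteq> 0\<^sub>v n"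
    "map_mat complex_of_real B *\<^sub>v v = z \<cdot>\<^sub>v v"
    using BD(1) by (auto simp: eigenvalue_def eigenvector_def)
  obtain i where i: "i < n" "v $ i \<noteq> 0"
    using v(1,2) by (metis carrier_vecD eq_vecI index_zero_vec)
  define c where "c = Max ((\<lambda>i. cmod (v $ i)) ` {..<n})"
  have c: "cmod (v $ j) \<le> c" if "j < n" for j
    unfolding c_def using that by (intro Max_ge) auto
  have "c \<in> (\<lambda>i. cmod (v $ i)) ` {..<n}" unfolding c_def using i(1) by (intro Max_in) auto
  then obtain m where m: "m < n" "cmod (v $ m) = c" by auto
  have "0 < c" using c[OF i(1)] i(2) by (smt (verit) zero_less_norm_iff)
  have "z * v $ m = (map_mat complex_of_real B *\<^sub>v v) $ m" using v m by simp
  also have "\<dots> = (\<Sum>j<n. complex_of_real (B $$ (m, j)) * v $ j)"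
    using BD(1) v(1) m(1) by (simp add: scalar_prod_def atLeast0LessThan)
  finally have "cmod z * c = cmod (\<Sum>j<n. complex_of_real (B $$ (m, j)) * v $ j)"
    using m(2) by (metis norm_mult)
  also have "\<dots> \<le> (\<Sum>j<n. B $$ (m, j) * c)"
  proof (rule sum_norm_le)
    fix j assume "j \<in> {..<n}"
    then show "cmod (complex_of_real (B $$ (m, j)) * v $ j) \<le> B $$ (m, j) * c"
      using BD(2)[OF m(1), of j] c[of j] by (auto simp: norm_mult intro: mult_left_mono)
  qed
  also have "\<dots> = r * c" using BD(3)[OF m(1)] by (simp add: sum_distrib_right[symmetric])
  finally show ?thesis using \<open>0 < c\<close> by simp
qed

section \<open>Deflation\<close>

text \<open>A matrix with constant row sums has the all-ones vector as an eigenvector; this is the matrix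
  induced on the quotient by that vector.\<close>
definition deflate :: "nat \<Rightarrow> 'a :: comm_ring_1 mat \<Rightarrow> 'a mat" where
  "deflate m B = mat m m (\<lambda>(i, j). B $$ (Suc i, Suc j) - B $$ (0, Suc j))"

text \<open>In the basis formed by the all-ones vector and the unit vectors other than the first,
  \<open>B\<close> becomes block upper triangular with diagonal blocks \<open>r\<close> and
  \<open>deflate m B\<close>.\<close>

lemma char_poly_deflate:
  fixes B :: "'a :: idom mat"
  assumes B: "B \<in> carrier_mat (Suc m) (Suc m)"
    and row: "\<And>i. i < Suc m \<Longrightarrow> (\<Sum>j<Suc m. B $$ (i, j)) = r"
  shows "char_poly B = [:- r, 1:] * char_poly (deflate m B)"
proof -
  let ?n = "Suc m"
  \<comment> \<open>\<open>S 1\<close> is the change of basis: its first column is all ones. The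
    parameter provides the inverse as \<open>S (- 1)\<close>. Left multiplication by
    \<open>S c\<close> adds \<open>c\<close> times row 0 to every other row.\<close>
  define S :: "'a \<Rightarrow> 'a mat"
    where "S c = mat ?n ?n (\<lambda>(i, j). if i = j then 1 else if j = 0 then c else 0)" for c
  define T where "T = four_block_mat (mat 1 1 (\<lambda>_. r)) (mat 1 m (\<lambda>(i, j). B $$ (0, Suc j)))
    (0\<^sub>m m 1) (deflate m B)"
  have S: "S c \<in> carrier_mat ?n ?n" for c by (simp add: S_def)
  have T: "T \<in> carrier_mat ?n ?n"
    using four_block_carrier_mat[of "mat 1 1 (\<lambda>_. r)" 1 1 "deflate m B" m m]
    by (simp add: T_def deflate_def)
  have S_mult: "(S c * M) $$ (i, j) = M $$ (i, j) + (if i = 0 then 0 else c * M $$ (0, j))"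
    if "M \<in> carrier_mat ?n ?n" "i < ?n" "j < ?n" for c M i j
  proof -
    have "(S c * M) $$ (i, j) = (\<Sum>k<?n. S c $$ (i, k) * M $$ (k, j))"
      using that S[of c] by (simp add: scalar_prod_def atLeast0LessThan)
    also have "\<dots> = (if i = 0 then 1 else c) * M $$ (0, j) + (\<Sum>k<m. if i = Suc k then M $$ (Suc k, j) else 0)"
      unfolding sum.lessThan_Suc_shift using that(2) by (auto simp: S_def intro!: sum.cong)
    also have "(\<Sum>k<m. if i = Suc k then M $$ (Suc k, j) else 0) = (if i = 0 then 0 else M $$ (i, j))"
      using that(2) by (cases i) auto
    finally show ?thesis by simp
  qed
  have inv: "S c * S (- c) = 1\<^sub>m ?n" for c
  proof (rule eq_matI)
    fix i j assume "i < dim_row (1\<^sub>m ?n :: 'a mat)" "j < dim_col (1\<^sub>m ?n :: 'a mat)"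
    then have ij: "i < ?n" "j < ?n" by auto
    show "(S c * S (- c)) $$ (i, j) = 1\<^sub>m ?n $$ (i, j)"
      unfolding S_mult[OF S ij] using ij by (auto simp: S_def)
  qed (auto simp: S_def)
  have BS: "B * S 1 = S 1 * T"
  proof (rule eq_matI)
    fix i j assume "i < dim_row (S 1 * T)" "j < dim_col (S 1 * T)"
    then have ij: "i < ?n" "j < ?n" using S[of 1] T by auto
    have "(B * S 1) $$ (i, j) = (\<Sum>k<?n. B $$ (i, k) * S 1 $$ (k, j))"
      using ij B S[of 1] by (simp add: scalar_prod_def atLeast0LessThan)
    also have "\<dots> = (\<Sum>k<?n. if k = j \<or> j = 0 then B $$ (i, k) else 0)"
      using ij(2) by (intro sum.cong) (auto simp: S_def)
    also have "\<dots> = (if j = 0 then r else B $$ (i, j))"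
      using ij(2) row[OF ij(1)] by (auto simp del: sum.lessThan_Suc)
    also have "\<dots> = (S 1 * T) $$ (i, j)"
      unfolding S_mult[OF T ij] using ij by (cases i; cases j) (auto simp: T_def deflate_def)
    finally show "(B * S 1) $$ (i, j) = (S 1 * T) $$ (i, j)" .
  qed (use B S[of 1] T in auto)
  have "B = B * (S 1 * S (- 1))" using B by (simp add: inv)
  also have "\<dots> = B * S 1 * S (- 1)"
    by (rule assoc_mult_mat[OF B S S, symmetric])
  finally have "B = S 1 * T * S (- 1)" unfolding BS .
  then have "similar_mat B T"
    using inv[of 1] inv[of "- 1"] by (intro similar_matI[of _ _ "S 1" "S (- 1)" ?n]) (use B S T in auto)
  then have "char_poly B = char_poly T" by (rule char_poly_similar)
  also have "\<dots> = char_poly (mat 1 1 (\<lambda>_. r)) * char_poly (deflate m B)"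
    unfolding T_def by (rule char_poly_four_block_zeros_col) (auto simp: deflate_def)
  also have "char_poly (mat 1 1 (\<lambda>_. r)) = [:- r, 1:]"
    by (simp add: char_poly_defs det_single)
  finally show ?thesis .
qed

section \<open>Realizable lists\<close>

interpretation of_real_poly_hom: map_poly_inj_idom_hom "of_real :: real \<Rightarrow> complex" ..

lemma proots_prod_linear_factors:
  fixes as :: "'a :: idom list"
  shows "proots (\<Prod>a\<leftarrow>as. [:- a, 1:]) = mset as"
proof (induction as)
  case (Cons a as)
  have "(\<Prod>a\<leftarrow>as. [:- a, 1:]) \<noteq> 0" by (auto simp: prod_list_zero_iff)
  then show ?case
    using proots_mult[of "[:- a, 1:]" "\<Prod>a\<leftarrow>as. [:- a, 1:]"] Cons.IH by (simp del: mult_pCons_left)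
qed simp

lemma prod_list_linear_factors_eq_iff:
  fixes as bs :: "'a :: idom list"
  shows "(\<Prod>a\<leftarrow>as. [:- a, 1:]) = (\<Prod>b\<leftarrow>bs. [:- b, 1:]) \<longleftrightarrow> mset as = mset bs"
proof
  assume "(\<Prod>a\<leftarrow>as. [:- a, 1:]) = (\<Prod>b\<leftarrow>bs. [:- b, 1:])"
  then show "mset as = mset bs" by (metis proots_prod_linear_factors)
next
  assume "mset as = mset bs"
  then have "mset (map (\<lambda>a. [:- a, 1:]) as) = mset (map (\<lambda>a. [:- a, 1:]) bs)" by simp
  then show "(\<Prod>a\<leftarrow>as. [:- a, 1:]) = (\<Prod>b\<leftarrow>bs. [:- b, 1:])"
    by (metis prod_mset_prod_list)
qed

lemma char_poly_complex_of_real: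
  assumes "A \<in> carrier_mat n n"
  shows "char_poly (map_mat complex_of_real A) = map_poly complex_of_real (char_poly A)"
  using assms by (rule of_real_hom.char_poly_hom)

lemma spectrum_mset_eq_iff:
  assumes A: "A \<in> carrier_mat n n"
  shows "spectrum_mset A = mset ls \<longleftrightarrow>
    map_poly complex_of_real (char_poly A) = (\<Prod>z\<leftarrow>ls. [:- z, 1:])"
proof -
  obtain as where as: "char_poly (map_mat complex_of_real A) = (\<Prod>a\<leftarrow>as. [:- a, 1:])"
    using char_poly_factorized[of "map_mat complex_of_real A" n] A by auto
  then have "spectrum_mset A = mset as" by (simp add: spectrum_mset_def proots_prod_linear_factors)
  moreover have "map_poly complex_of_real (char_poly A) = (\<Prod>a\<leftarrow>as. [:- a, 1:])"
    using char_poly_complex_of_real[OF A] as by simp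
  ultimately show ?thesis by (simp add: prod_list_linear_factors_eq_iff)
qed

lemma spectrum_mset_nonneg_row_sum_mat:
  assumes "nonneg_row_sum_mat n r B" "z \<in># spectrum_mset B"
  shows "cmod z \<le> r"
  using assms nonneg_row_sum_mat_eigenvalue_le[OF assms(1), of z]
  by (cases "char_poly (map_mat complex_of_real B) = 0") (auto simp: spectrum_mset_def)

lemma eigenvalue_nonneg_row_sum_mat:
  assumes "nonneg_row_sum_mat (Suc m) r B"
  shows "eigenvalue B r"
  using nonneg_row_sum_matD[OF assms] eigenvalue_root_char_poly[of B "Suc m" r]
    char_poly_deflate[of B m r] by simp

text \<open>This separates the two data: \<open>r\<close> enters only as the row sum,
  \<open>ls\<close> only through the deflated matrix. Hence \<open>r\<close> can be moved while the
  other eigenvalues stay fixed.\<close>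

lemma realizable_iff:
  "realizable r ls \<longleftrightarrow> (\<exists>B. nonneg_row_sum_mat (Suc (length ls)) r B \<and>
     map_poly complex_of_real (char_poly (deflate (length ls) B)) = (\<Prod>z\<leftarrow>ls. [:- z, 1:]))"
proof -
  let ?m = "length ls" and ?n = "Suc (length ls)"
  have split: "spectrum_mset B = mset (complex_of_real r # ls) \<longleftrightarrow>
      map_poly complex_of_real (char_poly (deflate ?m B)) = (\<Prod>z\<leftarrow>ls. [:- z, 1:])"
    if B: "nonneg_row_sum_mat ?n r B" for B
  proof -
    have "char_poly B = [:- r, 1:] * char_poly (deflate ?m B)"
      using nonneg_row_sum_matD[OF B] by (intro char_poly_deflate) auto
    then have "map_poly complex_of_real (char_poly B) =
        [:- complex_of_real r, 1:] * map_poly complex_of_real (char_poly (deflate ?m B))"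
      by (simp add: of_real_poly_hom.hom_mult del: mult_pCons_left)
    moreover have "[:- complex_of_real r, 1:] * p = [:- complex_of_real r, 1:] * q \<longleftrightarrow> p = q" for p q
      by (subst mult_cancel_left) simp
    ultimately show ?thesis
      using spectrum_mset_eq_iff[OF nonneg_row_sum_matD(1)[OF B], of "complex_of_real r # ls"]
      by (simp del: mult_pCons_left)
  qed
  show ?thesis
  proof
    assume "realizable r ls"
    then obtain A where A: "A \<in> carrier_mat ?n ?n" "\<forall>a\<in>elements_mat A. 0 \<le> a"
      "spectrum_mset A = mset (complex_of_real r # ls)" "perron_eigenvalue A r"
      by (auto simp: realizable_def)
    obtain r' B where B: "nonneg_row_sum_mat ?n r' B" "char_poly B = char_poly A"
      using cospectral_nonneg_row_sum_mat[OF A(1)] A by (auto intro: elements_matI[OF A(1)])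
    have same: "spectrum_mset B = spectrum_mset A"
      using char_poly_complex_of_real[OF A(1)]
        char_poly_complex_of_real[OF nonneg_row_sum_matD(1)[OF B(1)]] B(2)
      by (simp add: spectrum_mset_def)
    \<comment> \<open>The new row sum \<open>r'\<close> must be \<open>r\<close>: as an eigenvalue
      of \<open>A\<close> it is at most the Perron eigenvalue \<open>r\<close>, and
      \<open>r\<close>, as an eigenvalue of \<open>B\<close>, is at most the row sum
      \<open>r'\<close>.\<close>
    have "eigenvalue A r'"
      using eigenvalue_nonneg_row_sum_mat[OF B(1)] B(2)
        eigenvalue_root_char_poly[OF A(1)] eigenvalue_root_char_poly[OF nonneg_row_sum_matD(1)[OF B(1)]]
      by simp
    have "poly (char_poly (map_mat complex_of_real A)) (complex_of_real r') = 0"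
      using \<open>eigenvalue A r'\<close> eigenvalue_root_char_poly[OF A(1)]
        char_poly_complex_of_real[OF A(1)]
      by simp
    moreover have "char_poly (map_mat complex_of_real A) \<noteq> 0"
      using degree_monic_char_poly[of "map_mat complex_of_real A" ?n] A(1) by fastforce
    ultimately have "complex_of_real r' \<in># spectrum_mset A"
      by (simp add: spectrum_mset_def)
    then have "r' \<le> r" using A(4) by (force simp: perron_eigenvalue_def)
    moreover have "complex_of_real r \<in># spectrum_mset B" using same A(3) by simp
    then have "r \<le> r'" using spectrum_mset_nonneg_row_sum_mat[OF B(1)] by force
    ultimately have "r' = r" by simp
    then show "\<exists>B. nonneg_row_sum_mat ?n r B \<and>
        map_poly complex_of_real (char_poly (deflate ?m B)) = (\<Prod>z\<leftarrow>ls. [:- z, 1:])"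
      using B(1) split[of B] same A(3) by auto
  next
    assume "\<exists>B. nonneg_row_sum_mat ?n r B \<and>
        map_poly complex_of_real (char_poly (deflate ?m B)) = (\<Prod>z\<leftarrow>ls. [:- z, 1:])"
    then obtain B where B: "nonneg_row_sum_mat ?n r B"
      "map_poly complex_of_real (char_poly (deflate ?m B)) = (\<Prod>z\<leftarrow>ls. [:- z, 1:])" by blast
    have "perron_eigenvalue B r"
      using nonneg_row_sum_mat_nonneg[OF B(1)] eigenvalue_nonneg_row_sum_mat[OF B(1)]
        spectrum_mset_nonneg_row_sum_mat[OF B(1)]
      by (auto simp: perron_eigenvalue_def)
    moreover have "\<forall>a\<in>elements_mat B. 0 \<le> a"
      using nonneg_row_sum_matD[OF B(1)] by auto
    ultimately show "realizable r ls"
      using B split[OF B(1)] nonneg_row_sum_matD(1)[OF B(1)] unfolding realizable_def by blast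
  qed
qed

section \<open>Monotonicity and closedness of the set of realizable values\<close>

lemma realizable_mono:
  assumes "realizable r ls" "r \<le> r'"
  shows "realizable r' ls"
proof -
  let ?m = "length ls" and ?n = "Suc (length ls)"
  obtain B where B: "nonneg_row_sum_mat ?n r B"
    "map_poly complex_of_real (char_poly (deflate ?m B)) = (\<Prod>z\<leftarrow>ls. [:- z, 1:])"
    using assms(1) by (auto simp: realizable_iff)
  define B' where "B' = mat ?n ?n (\<lambda>(i, j). B $$ (i, j) + (if j = 0 then r' - r else 0))"
  have "nonneg_row_sum_mat ?n r' B'"
    unfolding nonneg_row_sum_mat_def
  proof (intro conjI allI impI)
    show "B' \<in> carrier_mat ?n ?n" by (simp add: B'_def)
    fix i assume i: "i < ?n"
    show "0 \<le> B' $$ (i, j)" if "j < ?n" for j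
      using nonneg_row_sum_matD(2)[OF B(1) i that] i that assms(2) by (simp add: B'_def)
    have "(\<Sum>j<?n. B' $$ (i, j)) = (\<Sum>j<?n. B $$ (i, j)) + (\<Sum>j<?n. if j = 0 then r' - r else 0)"
      unfolding sum.distrib[symmetric] using i by (intro sum.cong) (auto simp: B'_def)
    also have "\<dots> = r'"
      using nonneg_row_sum_matD(3)[OF B(1) i] by (simp del: sum.lessThan_Suc)
    finally show "(\<Sum>j<?n. B' $$ (i, j)) = r'" .
  qed
  \<comment> \<open>\<open>deflate\<close> reads only the columns from index 1 on, so a change in
    column 0 is invisible to it.\<close>
  moreover have "deflate ?m B' = deflate ?m B"
    unfolding deflate_def by (intro eq_matI) (auto simp: B'_def)
  ultimately show ?thesis using B(2) by (auto simp: realizable_iff)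
qed

text \<open>The deflated matrices may vary with \<open>k\<close>, but they share one characteristic
  polynomial \<open>c\<close>. So the full characteristic polynomials converge to the linear factor
  at \<open>r0\<close> times \<open>c\<close>, and compactness supplies a matrix with that
  polynomial and row sum \<open>r0\<close>.\<close>

lemma realizable_limit:
  assumes real: "\<And>k. realizable (r k) ls" and lim: "r \<longlonglongrightarrow> r0"
  shows "realizable r0 ls"
proof -
  let ?m = "length ls" and ?n = "Suc (length ls)"
  have "\<forall>k. \<exists>B. nonneg_row_sum_mat ?n (r k) B \<and>
     map_poly complex_of_real (char_poly (deflate ?m B)) = (\<Prod>z\<leftarrow>ls. [:- z, 1:])"
    using real realizable_iff by blast
  then obtain X where X: "\<And>k. nonneg_row_sum_mat ?n (r k) (X k)"
    "\<And>k. map_poly complex_of_real (char_poly (deflate ?m (X k))) = (\<Prod>z\<leftarrow>ls. [:- z, 1:])"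
    by metis
  define c where "c = char_poly (deflate ?m (X 0))"
  have "char_poly (deflate ?m (X k)) = c" for k
    unfolding c_def using X(2)[of k] X(2)[of 0] of_real_poly_hom.injectivity by metis
  then have cp: "char_poly (X k) = [:- r k, 1:] * c" for k
    using char_poly_deflate[of "X k" ?m "r k"] nonneg_row_sum_matD[OF X(1)[of k]] by simp
  have "(\<lambda>k. poly (char_poly (X k)) t) \<longlonglongrightarrow> poly ([:- r0, 1:] * c) t" for t
    unfolding cp poly_mult using lim by (auto intro!: tendsto_intros)
  then obtain f r' B where f: "strict_mono (f :: nat \<Rightarrow> nat)" "(\<lambda>k. r (f k)) \<longlonglongrightarrow> r'"
    and B: "nonneg_row_sum_mat ?n r' B" "char_poly B = [:- r0, 1:] * c"
    using nonneg_row_sum_mat_limit[of ?n r X "[:- r0, 1:] * c"] X(1) convergent_imp_Bseq[OF convergentI[OF lim]]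
    by blast
  have "r' = r0"
    using LIMSEQ_unique[OF f(2)] LIMSEQ_subseq_LIMSEQ[OF lim f(1)] by (simp add: o_def)
  then have B: "nonneg_row_sum_mat ?n r0 B" "char_poly B = [:- r0, 1:] * c" using B by simp_all
  have "[:- r0, 1:] * char_poly (deflate ?m B) = [:- r0, 1:] * c"
    using char_poly_deflate[of B ?m r0] nonneg_row_sum_matD[OF B(1)] B(2) by simp
  then have "char_poly (deflate ?m B) = c" by (subst (asm) mult_cancel_left) auto
  then show ?thesis using B(1) X(2)[of 0] by (auto simp: realizable_iff c_def)
qed

section \<open>A realization with Perron root n |w|\<close>

lemma char_poly_block_diag:
  fixes A :: "'a :: idom mat"
  assumes A: "A \<in> carrier_mat n n" and D: "D \<in> carrier_mat m m"
  shows "char_poly (four_block_mat A (0\<^sub>m n m) (0\<^sub>m m n) D) = char_poly A * char_poly D"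
proof -
  have "char_poly_matrix (four_block_mat A (0\<^sub>m n m) (0\<^sub>m m n) D) =
      four_block_mat (char_poly_matrix A) (0\<^sub>m n m) (0\<^sub>m m n) (char_poly_matrix D)"
    by (rule eq_matI) (use A D in \<open>auto simp: char_poly_matrix_def\<close>)
  then show ?thesis
    unfolding char_poly_def
    using det_four_block_mat_lower_left_zero[of "char_poly_matrix A" n "0\<^sub>m n m" m "0\<^sub>m m n" "char_poly_matrix D"]
      A D by simp
qed

text \<open>The real matrix of multiplication by \<open>z\<close> or by its conjugate. The absolute
  value puts the negative off-diagonal entry in column 0 whichever member of the pair
  \<open>z\<close> is.\<close>

lemma char_poly_rotation_block:
  fixes z :: complex
  shows "map_poly complex_of_real (char_poly (mat 2 2 (\<lambda>(i, j). if i = j then Re z else if j = 0 then - \<bar>Im z\<bar> else \<bar>Im z\<bar>)))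
    = [:- z, 1:] * [:- cnj z, 1:]"
proof -
  have det2: "det M = M $$ (0, 0) * M $$ (1, 1) - M $$ (0, 1) * M $$ (1, 0)"
    if "M \<in> carrier_mat 2 2" for M :: "real poly mat"
    using laplace_expansion_column[OF that, of 0] that
    by (auto simp: numeral_2_eq_2 cofactor_def mat_delete_def det_single)
  have "char_poly (mat 2 2 (\<lambda>(i, j). if i = j then Re z else if j = 0 then - \<bar>Im z\<bar> else \<bar>Im z\<bar>))
      = [: (Re z)\<^sup>2 + (Im z)\<^sup>2, - 2 * Re z, 1:]"
    unfolding char_poly_def by (subst det2) (auto simp: char_poly_matrix_def power2_eq_square)
  then show ?thesis by (simp add: complex_eq_iff power2_eq_square)
qed

text \<open>The realizing matrix has top row \<open>b\<close> and deflates to \<open>C\<close>; its first column only fills up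
  the row sums.\<close>
lemma realizable_of_dominated:
  fixes C :: "real mat" and b :: "nat \<Rightarrow> real"
  assumes m: "length ls = m" and C: "C \<in> carrier_mat m m"
    and cp: "map_poly complex_of_real (char_poly C) = (\<Prod>z\<leftarrow>ls. [:- z, 1:])"
    and b: "\<And>j. j < m \<Longrightarrow> 0 \<le> b j" "\<And>i j. i < m \<Longrightarrow> j < m \<Longrightarrow> 0 \<le> b j + C $$ (i, j)"
    and r: "(\<Sum>j<m. b j) \<le> r" "\<And>i. i < m \<Longrightarrow> (\<Sum>j<m. b j + C $$ (i, j)) \<le> r"
  shows "realizable r ls"
proof -
  \<comment> \<open>Row 0 is \<open>b\<close> and row \<open>i > 0\<close> is \<open>b\<close> plus
    row \<open>i - 1\<close> of \<open>C\<close>, so subtracting row 0 gives back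
    \<open>C\<close>.\<close>
  define a where "a i j = b j + (if i = 0 then 0 else C $$ (i - 1, j))" for i j
  have a: "0 \<le> a i j" if "i < Suc m" "j < m" for i j
    using that b by (cases i) (auto simp: a_def)
  have a_sum: "(\<Sum>j<m. a i j) \<le> r" if "i < Suc m" for i
    using that r by (cases i) (auto simp: a_def)
  define B where "B = mat (Suc m) (Suc m) (\<lambda>(i, j). if j = 0 then r - (\<Sum>j<m. a i j) else a i (j - 1))"
  have "nonneg_row_sum_mat (Suc m) r B"
    unfolding nonneg_row_sum_mat_def
  proof (intro conjI allI impI)
    show "B \<in> carrier_mat (Suc m) (Suc m)" by (simp add: B_def)
    fix i assume i: "i < Suc m"
    show "0 \<le> B $$ (i, j)" if "j < Suc m" for j
      using i that a a_sum by (cases j) (auto simp: B_def)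
    show "(\<Sum>j<Suc m. B $$ (i, j)) = r"
      unfolding sum.lessThan_Suc_shift using i by (simp add: B_def)
  qed
  moreover have "deflate m B = C"
    unfolding deflate_def by (rule eq_matI) (use C in \<open>auto simp: B_def a_def\<close>)
  ultimately show ?thesis using m cp by (auto simp: realizable_iff)
qed

text \<open>A block with rows \<open>(x, \<bar>y\<bar>)\<close>, \<open>(- \<bar>y\<bar>, x)\<close> needs \<open>b\<close> to be at least \<open>max \<bar>y\<bar> (- x)\<close> and
  \<open>max 0 (- x)\<close>. The row sum \<open>x + \<bar>y\<bar>\<close> may exceed \<open>M\<close>, but only if \<open>x > 0\<close>, and then the block
  contributes at most \<open>M\<close> instead of \<open>2 * M\<close> to the sum of \<open>b\<close>.\<close>
lemma block_matrix_exists: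
  fixes zs :: "complex list"
  assumes "\<forall>z\<in>set zs. \<bar>Re z\<bar> \<le> M \<and> \<bar>Im z\<bar> \<le> M"
  shows "\<exists>C b. C \<in> carrier_mat (2 * length zs) (2 * length zs) \<and>
    map_poly complex_of_real (char_poly C) = (\<Prod>z\<leftarrow>zs @ map cnj zs. [:- z, 1:]) \<and>
    (\<forall>j<2 * length zs. 0 \<le> b j) \<and>
    (\<forall>i<2 * length zs. \<forall>j<2 * length zs. 0 \<le> b j + C $$ (i, j)) \<and>
    (\<Sum>j<2 * length zs. b j) \<le> 2 * real (length zs) * M \<and>
    (\<forall>i<2 * length zs. (\<Sum>j<2 * length zs. b j + C $$ (i, j)) \<le> (2 * real (length zs) + 1) * M)"
  using assms
proof (induction zs)
  case Nil
  show ?case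
    by (rule exI[of _ "0\<^sub>m 0 0"]) (simp add: char_poly_def char_poly_matrix_def)
next
  case (Cons z zs)
  let ?m = "2 * length zs" and ?k = "real (length zs)"
  have "\<forall>z\<in>set zs. \<bar>Re z\<bar> \<le> M \<and> \<bar>Im z\<bar> \<le> M" using Cons.prems by simp
  from Cons.IH[OF this] obtain C b where C: "C \<in> carrier_mat ?m ?m"
    "map_poly complex_of_real (char_poly C) = (\<Prod>z\<leftarrow>zs @ map cnj zs. [:- z, 1:])"
    and b: "\<And>j. j < ?m \<Longrightarrow> 0 \<le> b j" "\<And>i j. i < ?m \<Longrightarrow> j < ?m \<Longrightarrow> 0 \<le> b j + C $$ (i, j)"
    and sums: "(\<Sum>j<?m. b j) \<le> 2 * ?k * M"
      "\<And>i. i < ?m \<Longrightarrow> (\<Sum>j<?m. b j + C $$ (i, j)) \<le> (2 * ?k + 1) * M"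
    by blast
  have z: "\<bar>Re z\<bar> \<le> M" "\<bar>Im z\<bar> \<le> M" using Cons.prems by auto
  define D where "D = mat 2 2 (\<lambda>(i, j). if i = j then Re z else if j = 0 then - \<bar>Im z\<bar> else \<bar>Im z\<bar>)"
  have D: "D \<in> carrier_mat 2 2" by (simp add: D_def)
  define C' where "C' = four_block_mat D (0\<^sub>m 2 ?m) (0\<^sub>m ?m 2) C"
  define b' where "b' j = (if j = 0 then max \<bar>Im z\<bar> (- Re z) else if j = 1 then max 0 (- Re z) else b (j - 2))" for j
  have m': "2 * length (z # zs) = Suc (Suc ?m)" by simp
  have C': "C' \<in> carrier_mat (Suc (Suc ?m)) (Suc (Suc ?m))"
    using four_block_carrier_mat[OF D C(1)] by (simp add: C'_def)
  have entry: "C' $$ (i, j) = (if i < 2 then if j < 2 then D $$ (i, j) else 0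
      else if j < 2 then 0 else C $$ (i - 2, j - 2))" if "i < Suc (Suc ?m)" "j < Suc (Suc ?m)" for i j
    using that C(1) D by (auto simp: C'_def)
  have shift: "(\<Sum>j<Suc (Suc ?m). g j) = g 0 + g 1 + (\<Sum>j<?m. g (Suc (Suc j)))" for g :: "nat \<Rightarrow> real"
    unfolding sum.lessThan_Suc_shift by simp
  have "map_poly complex_of_real (char_poly C') = (\<Prod>z\<leftarrow>(z # zs) @ map cnj (z # zs). [:- z, 1:])"
    unfolding C'_def char_poly_block_diag[OF D C(1)] of_real_poly_hom.hom_mult C(2)
    unfolding D_def char_poly_rotation_block
    by (simp add: mult_ac del: mult_pCons_left mult_pCons_right)
  moreover have "0 \<le> b' j" if "j < Suc (Suc ?m)" for j
    using that b(1)[of "j - 2"] by (auto simp: b'_def)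
  moreover have "0 \<le> b' j + C' $$ (i, j)" if "i < Suc (Suc ?m)" "j < Suc (Suc ?m)" for i j
    unfolding entry[OF that] using that b(1)[of "j - 2"] b(2)[of "i - 2" "j - 2"]
    by (auto simp: b'_def D_def)
  moreover have new: "b' 0 + b' 1 \<le> 2 * M" using z by (auto simp: b'_def)
  then have "(\<Sum>j<Suc (Suc ?m). b' j) \<le> 2 * real (length (z # zs)) * M"
    unfolding shift using sums(1) by (simp add: b'_def algebra_simps)
  moreover have "(\<Sum>j<Suc (Suc ?m). b' j + C' $$ (i, j)) \<le> (2 * real (length (z # zs)) + 1) * M"
    if i: "i < Suc (Suc ?m)" for i
  proof (cases "i < 2")
    case True
    \<comment> \<open>For \<open>Re z \<ge> 0\<close> the left side is
      \<open>2 * \<bar>Im z\<bar> + Re z\<close>; otherwise it is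
      \<open>max \<bar>Im z\<bar> (- Re z) + \<bar>Im z\<bar>\<close>, at most \<open>2 * M\<close>.
      The older entries of \<open>b\<close> add at most \<open>2 * ?k * M\<close>, which gives the
      claimed bound exactly.\<close>
    have "b' 0 + b' 1 + Re z + \<bar>Im z\<bar> \<le> 3 * M" using z by (auto simp: b'_def max_def)
    moreover have "C' $$ (i, 0) + C' $$ (i, 1) \<le> Re z + \<bar>Im z\<bar>"
      using True i by (cases "i = 0") (auto simp: entry D_def less_2_cases_iff)
    ultimately show ?thesis
      unfolding shift using sums(1) True i by (simp add: entry b'_def algebra_simps)
  next
    case False
    \<comment> \<open>An old row is zero in the two new columns, so its sum grows only by
      \<open>b' 0 + b' 1\<close>, at most \<open>2 * M\<close>.\<close>
    then have "i - 2 < ?m" using i by auto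
    then show ?thesis
      unfolding shift using sums(2)[of "i - 2"] False i new
      by (simp add: entry b'_def algebra_simps)
  qed
  ultimately show ?case
    unfolding m' using C' by (intro exI[of _ C'] exI[of _ b']) auto
qed

lemma realizable_conjugate_pairs:
  assumes "\<forall>z\<in>set zs. \<bar>Re z\<bar> \<le> M \<and> \<bar>Im z\<bar> \<le> M" and "0 \<le> M"
  shows "realizable ((2 * real (length zs) + 1) * M) (zs @ map cnj zs)"
proof -
  let ?m = "2 * length zs"
  obtain C b where *: "C \<in> carrier_mat ?m ?m"
    "map_poly complex_of_real (char_poly C) = (\<Prod>z\<leftarrow>zs @ map cnj zs. [:- z, 1:])"
    "\<And>j. j < ?m \<Longrightarrow> 0 \<le> b j" "\<And>i j. i < ?m \<Longrightarrow> j < ?m \<Longrightarrow> 0 \<le> b j + C $$ (i, j)"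
    "(\<Sum>j<?m. b j) \<le> 2 * real (length zs) * M"
    "\<And>i. i < ?m \<Longrightarrow> (\<Sum>j<?m. b j + C $$ (i, j)) \<le> (2 * real (length zs) + 1) * M"
    using block_matrix_exists[OF assms(1)] by blast
  show ?thesis
  proof (rule realizable_of_dominated[OF _ *(1,2,3,4) _ *(6)])
    show "(\<Sum>j<?m. b j) \<le> (2 * real (length zs) + 1) * M"
      using *(5) assms(2) by (simp add: algebra_simps)
  qed auto
qed

section \<open>The least realizable value\<close>

lemma realizable_cong_mset:
  assumes "mset ls = mset ls'"
  shows "realizable r ls \<longleftrightarrow> realizable r ls'"
  using assms mset_eq_length[OF assms] by (simp add: realizable_def)

text \<open>The infimum of the realizable values exists because Perron eigenvalues are nonnegative.
  It is attained: every value above it is realizable by monotonicity, and limits of realizable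
  values are realizable.\<close>

lemma realizable_least:
  assumes "realizable R ls"
  shows "\<exists>r0\<le>R. \<forall>r. realizable r ls \<longleftrightarrow> r0 \<le> r"
proof -
  let ?S = "{r. realizable r ls}"
  define r0 where "r0 = Inf ?S"
  have bdd: "bdd_below ?S"
    by (rule bdd_belowI[of _ 0]) (auto simp: realizable_def perron_eigenvalue_def)
  have "realizable (r0 + inverse (real (Suc k))) ls" for k
  proof -
    have "\<exists>r\<in>?S. r < r0 + inverse (real (Suc k))"
      using cInf_less_iff[OF _ bdd, of "r0 + inverse (real (Suc k))"] assms by (auto simp: r0_def)
    then show ?thesis using realizable_mono by (auto intro: less_imp_le)
  qed
  moreover have "(\<lambda>k. r0 + inverse (real (Suc k))) \<longlonglongrightarrow> r0 + 0"
    by (intro tendsto_add tendsto_const LIMSEQ_inverse_real_of_nat)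
  ultimately have "realizable r0 ls" using realizable_limit by fastforce
  moreover have "r0 \<le> r" if "realizable r ls" for r
    unfolding r0_def by (rule cInf_lower[OF _ bdd]) (use that in simp)
  ultimately show ?thesis using assms realizable_mono by blast
qed

lemma realizable_cmod_le:
  assumes "realizable r ls" "z \<in> set ls"
  shows "cmod z \<le> r"
  using assms by (auto simp: realizable_def perron_eigenvalue_def)

theorem theorem3p4:
  fixes s n :: nat and lam :: "nat \<Rightarrow> complex" and x y :: "nat \<Rightarrow> real" and w :: real
  assumes s: "s \<ge> 2" and n: "n = 2 * s - 1"
    and closed_cnj: "image_mset (\<lambda>j. cnj (lam j)) (mset_set {2..n}) = image_mset lam (mset_set {2..n})"
    and nonreal: "\<And>j. j \<in> {2..n} \<Longrightarrow> lam j \<notin> \<real>"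
    and one_of_each_pair: "image_mset lam (mset_set {2..n}) =
           image_mset lam (mset_set {2..s}) + image_mset (\<lambda>i. cnj (lam i)) (mset_set {2..s})"
    and x: "\<And>i. i \<in> {2..s} \<Longrightarrow> x i = Re (lam i)"
    and y: "\<And>i. i \<in> {2..s} \<Longrightarrow> y i = Im (lam i)"
    and w: "w = Min (\<Union>i\<in>{2..s}. {x i, - x i, y i, - y i})"
  defines "P \<equiv> (\<lambda>lam0::real.
      Max ((\<lambda>j. cmod (lam j)) ` {2..n}) \<le> lam0 \<and> lam0 \<le> real n * \<bar>w\<bar> \<and>
      (\<forall>lam1::real. realizable lam1 (map lam [2..<Suc n]) \<longleftrightarrow> lam0 \<le> lam1))"
  shows "\<exists>lam0. P lam0 \<and> (\<forall>mu. P mu \<longrightarrow> lam0 \<le> mu)"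
proof -
  let ?ls = "map lam [2..<Suc n]" and ?zs = "map lam [2..<Suc s]"
  have mset_map: "mset (map f [2..<Suc k]) = image_mset f (mset_set {2..k})" for f :: "nat \<Rightarrow> complex" and k
    by (simp only: mset_map mset_upt atLeastLessThanSuc_atLeastAtMost)
  have "mset ?ls = mset (?zs @ map cnj ?zs)"
    using one_of_each_pair unfolding mset_append map_map o_def mset_map by simp
  moreover have "realizable (real n * \<bar>w\<bar>) (?zs @ map cnj ?zs)"
  proof -
    \<comment> \<open>The set whose minimum is \<open>w\<close> is closed under negation, so
      \<open>w \<le> 0\<close> and \<open>- w\<close> is the largest of all
      \<open>\<bar>x i\<bar>\<close> and \<open>\<bar>y i\<bar>\<close>.\<close>
    have "\<bar>Re z\<bar> \<le> \<bar>w\<bar> \<and> \<bar>Im z\<bar> \<le> \<bar>w\<bar>" if "z \<in> set ?zs" for z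
    proof -
      obtain i where i: "i \<in> {2..s}" "z = lam i" using \<open>z \<in> set ?zs\<close> by (auto simp: less_Suc_eq_le simp del: upt_Suc)
      have "w \<le> v" if "v \<in> {x i, - x i, y i, - y i}" for v
        unfolding w using that i(1) by (intro Min_le) auto
      then have "w \<le> x i" "w \<le> - x i" "w \<le> y i" "w \<le> - y i" by auto
      then show ?thesis using x[OF i(1)] y[OF i(1)] i(2) by auto
    qed
    moreover have "real n = 2 * real (length ?zs) + 1" using n s by auto
    ultimately show ?thesis using realizable_conjugate_pairs[of ?zs "\<bar>w\<bar>"] by simp
  qed
  ultimately have "realizable (real n * \<bar>w\<bar>) ?ls" using realizable_cong_mset by blast
  then obtain r0 where r0: "r0 \<le> real n * \<bar>w\<bar>" "\<And>r. realizable r ?ls \<longleftrightarrow> r0 \<le> r"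
    using realizable_least by blast
  \<comment> \<open>The list is realizable at \<open>r0\<close> itself, so \<open>r0\<close> as
    Perron eigenvalue dominates every modulus.\<close>
  have "cmod (lam j) \<le> r0" if "j \<in> {2..n}" for j
    using realizable_cmod_le[of r0 ?ls "lam j"] r0(2)[of r0] that
    by (auto simp: less_Suc_eq_le simp del: upt_Suc)
  moreover have "{2..n} \<noteq> {}" using n s by auto
  ultimately have "Max ((\<lambda>j. cmod (lam j)) ` {2..n}) \<le> r0" by (subst Max_le_iff) auto
  then have "P r0" using r0 by (simp add: P_def)
  \<comment> \<open>The equivalence in \<open>P mu\<close>, taken at \<open>mu\<close>, shows that
    the list is realizable at \<open>mu\<close>.\<close>
  moreover have "r0 \<le> mu" if "P mu" for mu using that r0(2) unfolding P_def by blast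
  ultimately show ?thesis by blast
qed

end
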